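(* If $k\ge 1$ is an integer, then $$\operatorname{gp}(C_{11k}\boxtimes C_{11k})=11.$$
   Context: All graphs are finite, simple and connected. $d_G(u,v)$ is the usual shortest-path distance in $G$. A set $S\subseteq V(G)$ is a general position set of $G$ if no vertex of $S$ lies on a shortest path between two other vertices of $S$; equivalently, $d_G(u,v)\ne d_G(u,w)+d_G(w,v)$ for all pairwise distinct $u,v,w\in S$. The general position number $\operatorname{gp}(G)$ is the maximum cardinality of a general position set of $G$. The strong product $G\boxtimes H$ has vertex set $V(G)\times V(H)$; distinct vertices $(u_x,u_y)$ and $(v_x,v_y)$ are adjacent if and only if ($u_x=v_x$ and $u_yv_y\in E(H)$), or ($u_y=v_y$ and $u_xv_x\in E(G)$), or ($u_xv_x\in E(G)$ and $u_yv_y\in E(H)$). $C_n$ is the cycle on $n$ vertices. *)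

theory Defs
  imports "Graph_Theory.Graph_Theory"
begin

text \<open>
  A finite simple graph is a \<^locale>\<open>pair_graph\<close>: every undirected edge \<open>uv\<close> is present as the
  two arcs \<open>(u, v)\<close> and \<open>(v, u)\<close>.
\<close>

definition graph_dist :: "'a pair_pre_digraph \<Rightarrow> 'a \<Rightarrow> 'a \<Rightarrow> ereal" where
  "graph_dist G u v = wf_digraph.\<mu> (with_proj G) (\<lambda>_. 1) u v"

text \<open>
  A walk whose length is the distance of its ends repeats no vertex, so the walks below are
  exactly the shortest paths.
\<close>

definition shortest_path :: "'a pair_pre_digraph \<Rightarrow> 'a \<Rightarrow> ('a \<times> 'a) awalk \<Rightarrow> 'a \<Rightarrow> bool" where
  "shortest_path G u p v \<longleftrightarrow>
     pre_digraph.awalk (with_proj G) u p v \<and> ereal (real (length p)) = graph_dist G u v"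

definition general_position :: "'a pair_pre_digraph \<Rightarrow> 'a set \<Rightarrow> bool" where
  "general_position G S \<longleftrightarrow> S \<subseteq> pverts G \<and>
     (\<forall>u\<in>S. \<forall>v\<in>S. \<forall>w\<in>S. u \<noteq> v \<and> u \<noteq> w \<and> v \<noteq> w \<longrightarrow>
        \<not> (\<exists>p. shortest_path G u p v \<and>
               w \<in> set (pre_digraph.awalk_verts (with_proj G) u p)))"

definition gp :: "'a pair_pre_digraph \<Rightarrow> nat" where
  "gp G = Max (card ` {S. general_position G S})"

definition strong_product ::
  "'a pair_pre_digraph \<Rightarrow> 'b pair_pre_digraph \<Rightarrow> ('a \<times> 'b) pair_pre_digraph" (infixl "\<boxtimes>" 70) where
  "G \<boxtimes> H = \<lparr> pverts = pverts G \<times> pverts H,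
     parcs = {((ux, uy), (vx, vy)).
       (ux, uy) \<in> pverts G \<times> pverts H \<and> (vx, vy) \<in> pverts G \<times> pverts H \<and>
       (ux, uy) \<noteq> (vx, vy) \<and>
       ((ux = vx \<and> (uy, vy) \<in> parcs H) \<or>
        (uy = vy \<and> (ux, vx) \<in> parcs G) \<or>
        ((ux, vx) \<in> parcs G \<and> (uy, vy) \<in> parcs H))} \<rparr>"

text \<open>This is the cycle on \<open>n\<close> vertices only for \<open>n \<ge> 3\<close>.\<close>

definition cycle_graph :: "nat \<Rightarrow> nat pair_pre_digraph" where
  "cycle_graph n = \<lparr> pverts = {..<n},
     parcs = {(i, j). i < n \<and> j < n \<and> i \<noteq> j \<and> (j = Suc i mod n \<or> i = Suc j mod n)} \<rparr>"

lemma pair_graph_cycle_graph: "pair_graph (cycle_graph n)"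
proof unfold_locales
  have "parcs (cycle_graph n) \<subseteq> {..<n} \<times> {..<n}"
    by (auto simp: cycle_graph_def)
  then show "finite (parcs (cycle_graph n))"
    by (rule finite_subset) simp
qed (auto simp: cycle_graph_def symmetric_def intro!: symI)

lemma pair_graph_strong_product:
  assumes "pair_graph G" "pair_graph H"
  shows "pair_graph (G \<boxtimes> H)"
proof -
  interpret G: pair_graph G by fact
  interpret H: pair_graph H by fact
  have sG: "(v, u) \<in> parcs G" if "(u, v) \<in> parcs G" for u v
    using that G.pair_sym_arcs by (auto simp: symmetric_def dest: symD)
  have sH: "(v, u) \<in> parcs H" if "(u, v) \<in> parcs H" for u v
    using that H.pair_sym_arcs by (auto simp: symmetric_def dest: symD)
  show ?thesis
  proof unfold_locales
    have "parcs (G \<boxtimes> H) \<subseteq> (pverts G \<times> pverts H) \<times> (pverts G \<times> pverts H)"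
      by (auto simp: strong_product_def)
    then show "finite (parcs (G \<boxtimes> H))"
      by (rule finite_subset) simp
  qed (auto simp: strong_product_def symmetric_def intro!: symI dest: sG sH)
qed

lemma graph_dist_le_length:
  assumes "pair_graph G" "pre_digraph.awalk (with_proj G) u p v"
  shows "graph_dist G u v \<le> ereal (real (length p))"
proof -
  interpret pair_graph G by fact
  have "awalk_cost (\<lambda>_. 1) p = real (length p)"
    by (induct p) auto
  then show ?thesis
    using min_cost_le_walk_cost[OF assms(2), of "\<lambda>_. 1"] by (simp add: graph_dist_def)
qed

lemma shortest_path_exists:
  assumes "pair_graph G" "strongly_connected (with_proj G)" "u \<in> pverts G" "v \<in> pverts G"
  obtains p where "shortest_path G u p v"
proof -
  interpret pair_graph G by fact
  have cost: "awalk_cost (\<lambda>_. 1) p = real (length p)" for p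
    by (induct p) auto
  have "u \<rightarrow>\<^sup>*\<^bsub>with_proj G\<^esub> v"
    using assms(2-4) by (auto simp: strongly_connected_def)
  from min_cost_awalk[OF this, of "\<lambda>_. 1"] obtain p
    where "apath u p v" "\<mu> (\<lambda>_. 1) u v = awalk_cost (\<lambda>_. 1) p" by auto
  then have "shortest_path G u p v"
    by (simp add: shortest_path_def graph_dist_def cost apath_def)
  then show ?thesis by (rule that)
qed

lemma on_shortest_path_iff:
  assumes G: "pair_graph G" and conn: "strongly_connected (with_proj G)"
    and verts: "u \<in> pverts G" "v \<in> pverts G" "w \<in> pverts G"
  shows "(\<exists>p. shortest_path G u p v \<and> w \<in> set (pre_digraph.awalk_verts (with_proj G) u p))
    \<longleftrightarrow> graph_dist G u v = graph_dist G u w + graph_dist G w v"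
    (is "?L \<longleftrightarrow> ?R")
proof -
  interpret pair_graph G by fact
  obtain q r where q: "shortest_path G u q w" and r: "shortest_path G w r v"
    using shortest_path_exists[OF G conn] verts by metis
  have walk: "awalk u (q @ r) v" "awalk u q w" "awalk w r v"
    using q r by (auto simp: shortest_path_def intro: awalk_appendI)
  have len: "graph_dist G u w + graph_dist G w v = ereal (real (length (q @ r)))"
    using q r by (simp add: shortest_path_def flip: plus_ereal.simps(1))
  show ?thesis
  proof
    assume ?L
    then obtain p where p: "awalk u p v" "ereal (real (length p)) = graph_dist G u v"
      "w \<in> set (awalk_verts u p)"
      by (auto simp: shortest_path_def)
    obtain a b where ab: "p = a @ b" "awalk u a w" "awalk w b v"
      using awalk_decomp[OF p(1,3)] by blast
    have "graph_dist G u w + graph_dist G w v \<le> ereal (real (length a)) + ereal (real (length b))"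
      by (intro add_mono graph_dist_le_length G ab)
    also have "\<dots> = graph_dist G u v"
      using p(2) ab(1) by simp
    finally show ?R
      using graph_dist_le_length[OF G walk(1)] len by simp
  next
    assume ?R
    then have "shortest_path G u (q @ r) v"
      using walk(1) len by (simp add: shortest_path_def)
    moreover have "w \<in> set (awalk_verts u (q @ r))"
      using set_awalk_verts_append[OF walk(2,3)] by (cases r) (use walk(3) in \<open>auto simp: awalk_def\<close>)
    ultimately show ?L by (auto simp: awalk_verts_with_proj_eq)
  qed
qed

lemma general_position_iff_dist:
  assumes "pair_graph G" "strongly_connected (with_proj G)"
  shows "general_position G S \<longleftrightarrow> S \<subseteq> pverts G \<and>
    (\<forall>u\<in>S. \<forall>v\<in>S. \<forall>w\<in>S. u \<noteq> v \<and> u \<noteq> w \<and> v \<noteq> w \<longrightarrow>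
       graph_dist G u v \<noteq> graph_dist G u w + graph_dist G w v)"
proof (cases "S \<subseteq> pverts G")
  case True
  then show ?thesis
    unfolding general_position_def
    by (simp add: on_shortest_path_iff[OF assms] subset_iff)
next
  case False
  then show ?thesis by (simp add: general_position_def)
qed

lemma strongly_connected_cycle_graph:
  assumes "n > 0"
  shows "strongly_connected (with_proj (cycle_graph n))"
proof -
  interpret pair_graph "cycle_graph n" by (rule pair_graph_cycle_graph)
  have up: "0 \<rightarrow>\<^sup>*\<^bsub>with_proj (cycle_graph n)\<^esub> i" if "i < n" for i
    using that
  proof (induct i)
    case 0 show ?case using assms by (intro reachable_refl) (simp add: cycle_graph_def)
  next
    case (Suc i)
    then have "(i, Suc i) \<in> parcs (cycle_graph n)" by (auto simp: cycle_graph_def)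
    with Suc show ?case by (auto intro: reachable_adj_trans)
  qed
  have "i \<rightarrow>\<^sup>*\<^bsub>with_proj (cycle_graph n)\<^esub> 0" if "i < n" for i
    using up[OF that] symmetric_reachable[OF sym_arcs] by blast
  then have "i \<rightarrow>\<^sup>*\<^bsub>with_proj (cycle_graph n)\<^esub> j" if "i < n" "j < n" for i j
    using reachable_trans up that by blast
  moreover have "pverts (cycle_graph n) = {..<n}"
    by (simp add: cycle_graph_def)
  ultimately show ?thesis
    using assms by (auto simp: strongly_connected_def)
qed

lemma strongly_connected_strong_product:
  assumes "pair_graph G" "pair_graph H"
    and "strongly_connected (with_proj G)" "strongly_connected (with_proj H)"
  shows "strongly_connected (with_proj (G \<boxtimes> H))"
proof -
  interpret G: pair_graph G by fact
  interpret H: pair_graph H by fact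
  interpret P: pair_graph "G \<boxtimes> H" by (intro pair_graph_strong_product assms)
  have pverts_prod: "pverts (G \<boxtimes> H) = pverts G \<times> pverts H"
    by (simp add: strong_product_def)
  have horiz: "(u, y) \<rightarrow>\<^sup>*\<^bsub>with_proj (G \<boxtimes> H)\<^esub> (v, y)"
    if "u \<rightarrow>\<^sup>*\<^bsub>with_proj G\<^esub> v" "y \<in> pverts H" for u v y
    using that(1)
  proof (induct rule: G.reachable_induct)
    case base then show ?case using that(2) P.reachable_refl by (auto simp: pverts_prod)
  next
    case (step x z)
    then have "((x, y), (z, y)) \<in> parcs (G \<boxtimes> H)"
      using that(2) by (auto simp: strong_product_def dest: G.pair_no_loops G.wellformed')
    with step show ?case by (auto intro: P.reachable_adj_trans)
  qed
  have vert: "(x, u) \<rightarrow>\<^sup>*\<^bsub>with_proj (G \<boxtimes> H)\<^esub> (x, v)"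
    if "u \<rightarrow>\<^sup>*\<^bsub>with_proj H\<^esub> v" "x \<in> pverts G" for u v x
    using that(1)
  proof (induct rule: H.reachable_induct)
    case base then show ?case using that(2) P.reachable_refl by (auto simp: pverts_prod)
  next
    case (step y z)
    then have "((x, y), (x, z)) \<in> parcs (G \<boxtimes> H)"
      using that(2) by (auto simp: strong_product_def dest: H.pair_no_loops H.wellformed')
    with step show ?case by (auto intro: P.reachable_adj_trans)
  qed
  have "(a, b) \<rightarrow>\<^sup>*\<^bsub>with_proj (G \<boxtimes> H)\<^esub> (c, d)"
    if "a \<in> pverts G" "c \<in> pverts G" "b \<in> pverts H" "d \<in> pverts H" for a b c d
    using horiz[of a c b] vert[of b d c] that assms(3,4)
    by (auto simp: strongly_connected_def intro: P.reachable_trans)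
  then show ?thesis
    using assms(3,4) by (auto simp: strongly_connected_def strong_product_def)
qed

end

theory Submission
  imports Defs
begin

text \<open>
  The distance in a strong product is the larger of the distances in the factors, so
  \<open>C\<^sub>m \<boxtimes> C\<^sub>n\<close> is a discrete torus with the maximum metric.  Two distinct points of it are either
  joined by a vertical displacement (the second coordinate strictly dominates) or by a horizontal
  one.  Betweenness follows the cycles: if three points are such that the displacements all have
  the same dominant coordinate and the middle point is between the others in that coordinate, then
  it is on a shortest path.

  The upper bound holds on every torus and comes from two counts.  A set of points whose mutual
  displacements are all vertical has at most 3 elements, because of four points on a cycle some
  three lie on a common geodesic (\<open>card_vertical_le_3\<close>).  In a vertical strip that covers half of
  the first cycle, the horizontal displacements define a strict partial order.  Its chains lie on
  shortest paths, so in a general position set there is no chain of three points, and the points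
  of the strip split into two antichains, the minimal points and the others.  An antichain
  has only vertical displacements.  Hence a half strip contains at most \<open>3 + 3\<close> points
  (\<open>card_half_strip_le_6\<close>).  The half strips that begin and end at the column of a point \<open>p\<close> of the
  set cover the torus and share \<open>p\<close>, so the set has at most \<open>6 + 6 - 1 = 11\<close> points.

  For the lower bound, the multiples of \<open>(1, 3)\<close> form a lattice of 11 points in the torus of
  side 11 in which all distances are between 3 and 5.  As \<open>3 + 3 > 5\<close>, no point is between two
  others, and dilating by \<open>k\<close> preserves this.
\<close>

section \<open>Distances in strong products of cycles\<close>

text \<open>
  A local characterisation of the graph distance: moving along an arc changes the value by at most
  one, and some arc decreases it.  Unlike the distance itself, it is checked one arc at a time, and
  it passes to strong products.
\<close>

definition is_distance :: "'a pair_pre_digraph \<Rightarrow> ('a \<Rightarrow> 'a \<Rightarrow> nat) \<Rightarrow> bool" where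
  "is_distance G f \<longleftrightarrow>
     (\<forall>u\<in>pverts G. \<forall>v\<in>pverts G. f u v = 0 \<longleftrightarrow> u = v) \<and>
     (\<forall>u v w. (u, v) \<in> parcs G \<longrightarrow> w \<in> pverts G \<longrightarrow> f u w \<le> Suc (f v w)) \<and>
     (\<forall>u\<in>pverts G. \<forall>w\<in>pverts G. u \<noteq> w \<longrightarrow>
        (\<exists>v. (u, v) \<in> parcs G \<and> f u w = Suc (f v w)))"

lemma graph_dist_eq_is_distance:
  assumes G: "pair_graph G" and conn: "strongly_connected (with_proj G)"
    and f: "is_distance G f" and verts: "u \<in> pverts G" "w \<in> pverts G"
  shows "graph_dist G u w = ereal (real (f u w))"
proof -
  interpret pair_graph G by fact
  have lower: "f u w \<le> length p" if "awalk u p w" for p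
    using that
  proof (induct p arbitrary: u)
    case Nil
    then show ?case using f by (auto simp: is_distance_def awalk_def)
  next
    case (Cons e p)
    obtain v where e: "e = (u, v)" "(u, v) \<in> parcs G" "awalk v p w"
      using Cons.prems by (cases e) (auto simp: awalk_Cons_iff)
    have "f u w \<le> Suc (f v w)"
      using f e(2) verts(2) by (auto simp: is_distance_def)
    with Cons.hyps[OF e(3)] show ?case by simp
  qed
  have "\<exists>p. awalk u p w \<and> length p = f u w"
    using verts(1)
  proof (induct "f u w" arbitrary: u)
    case 0
    then have "u = w" using f verts(2) by (auto simp: is_distance_def)
    with 0 show ?case by (intro exI[of _ "[]"]) (simp add: awalk_def)
  next
    case (Suc d)
    then have "u \<noteq> w" using f verts(2) by (metis is_distance_def nat.distinct(1))
    then obtain v where v: "(u, v) \<in> parcs G" "f u w = Suc (f v w)"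
      using f Suc.prems verts(2) unfolding is_distance_def by blast
    then obtain p where "awalk v p w" "length p = f v w"
      using Suc.hyps(1)[of v] Suc.hyps(2) in_arcsD2 by (auto dest: wellformed')
    with v show ?case
      by (intro exI[of _ "(u, v) # p"]) (auto simp: awalk_Cons_iff)
  qed
  then obtain p where p: "awalk u p w" "length p = f u w" by blast
  obtain q where q: "shortest_path G u q w"
    using shortest_path_exists[OF G conn verts] .
  show ?thesis
  proof (rule antisym)
    show "graph_dist G u w \<le> ereal (real (f u w))"
      using graph_dist_le_length[OF G p(1)] p(2) by simp
    show "ereal (real (f u w)) \<le> graph_dist G u w"
      using lower[of q] q by (auto simp: shortest_path_def dest!: sym[of "ereal _"])
  qed
qed

lemma general_position_iff_is_distance:
  assumes G: "pair_graph G" and conn: "strongly_connected (with_proj G)"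
    and f: "is_distance G f"
  shows "general_position G S \<longleftrightarrow> S \<subseteq> pverts G \<and>
    (\<forall>u\<in>S. \<forall>v\<in>S. \<forall>w\<in>S. u \<noteq> v \<and> u \<noteq> w \<and> v \<noteq> w \<longrightarrow> f u v \<noteq> f u w + f w v)"
proof -
  have "graph_dist G u v \<noteq> graph_dist G u w + graph_dist G w v \<longleftrightarrow> f u v \<noteq> f u w + f w v"
    if "u \<in> pverts G" "v \<in> pverts G" "w \<in> pverts G" for u v w
    using that by (simp add: graph_dist_eq_is_distance[OF assms] flip: of_nat_add)
  then show ?thesis
    unfolding general_position_iff_dist[OF G conn] by (meson subsetD)
qed

lemma is_distance_strong_product:
  assumes G: "pair_graph G" and H: "pair_graph H" and f: "is_distance G f" and g: "is_distance H g"
  shows "is_distance (G \<boxtimes> H) (\<lambda>u v. max (f (fst u) (fst v)) (g (snd u) (snd v)))"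
proof -
  interpret G: pair_graph G by fact
  interpret H: pair_graph H by fact
  have zero: "f a c = 0 \<longleftrightarrow> a = c" if "a \<in> pverts G" "c \<in> pverts G" for a c
    using f that by (auto simp: is_distance_def)
  have zero': "g b d = 0 \<longleftrightarrow> b = d" if "b \<in> pverts H" "d \<in> pverts H" for b d
    using g that by (auto simp: is_distance_def)
  have lip: "f a c \<le> Suc (f a' c)" if "(a, a') \<in> parcs G \<or> a = a'" "c \<in> pverts G" for a a' c
    using f that by (auto simp: is_distance_def)
  have lip': "g b d \<le> Suc (g b' d)" if "(b, b') \<in> parcs H \<or> b = b'" "d \<in> pverts H" for b b' d
    using g that by (auto simp: is_distance_def)
  have step: "\<exists>a'. (a, a') \<in> parcs G \<and> f a c = Suc (f a' c)"
    if "a \<in> pverts G" "c \<in> pverts G" "a \<noteq> c" for a c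
    using f that by (auto simp: is_distance_def)
  have step': "\<exists>b'. (b, b') \<in> parcs H \<and> g b d = Suc (g b' d)"
    if "b \<in> pverts H" "d \<in> pverts H" "b \<noteq> d" for b d
    using g that by (auto simp: is_distance_def)
  have verts: "pverts (G \<boxtimes> H) = pverts G \<times> pverts H"
    by (simp add: strong_product_def)
  have arcs: "((a, b), (a', b')) \<in> parcs (G \<boxtimes> H) \<longleftrightarrow>
      (a, a') \<in> parcs G \<and> (b, b') \<in> parcs H \<or>
      (a, a') \<in> parcs G \<and> b = b' \<and> b \<in> pverts H \<or>
      (b, b') \<in> parcs H \<and> a = a' \<and> a \<in> pverts G" for a b a' b'
    using G.wellformed' H.wellformed' G.pair_no_loops H.pair_no_loops
    by (fastforce simp: strong_product_def)
  have step_prod: "\<exists>v. ((a, b), v) \<in> parcs (G \<boxtimes> H) \<and>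
      max (f a c) (g b d) = Suc (max (f (fst v) c) (g (snd v) d))"
    if ab: "a \<in> pverts G" "b \<in> pverts H" and cd: "c \<in> pverts G" "d \<in> pverts H"
      and ne: "(a, b) \<noteq> (c, d)" for a b c d
  proof -
    \<comment> \<open>Advance in every coordinate that is not yet correct.\<close>
    consider "a = c" "b \<noteq> d" | "a \<noteq> c" "b = d" | "a \<noteq> c" "b \<noteq> d" using ne by auto
    then show ?thesis
    proof cases
      case 1
      obtain b' where "(b, b') \<in> parcs H" "g b d = Suc (g b' d)"
        using step'[OF ab(2) cd(2) 1(2)] by blast
      then show ?thesis
        using 1 zero[of a c] ab cd by (intro exI[of _ "(a, b')"]) (auto simp: arcs)
    next
      case 2
      obtain a' where "(a, a') \<in> parcs G" "f a c = Suc (f a' c)"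
        using step[OF ab(1) cd(1) 2(1)] by blast
      then show ?thesis
        using 2 zero'[of b d] ab cd by (intro exI[of _ "(a', b)"]) (auto simp: arcs)
    next
      case 3
      obtain a' b' where "(a, a') \<in> parcs G" "f a c = Suc (f a' c)"
          "(b, b') \<in> parcs H" "g b d = Suc (g b' d)"
        using step[OF ab(1) cd(1) 3(1)] step'[OF ab(2) cd(2) 3(2)] by blast
      then show ?thesis
        by (intro exI[of _ "(a', b')"]) (auto simp: arcs)
    qed
  qed
  have lip_prod: "max (f a c) (g b d) \<le> Suc (max (f a' c) (g b' d))"
    if "((a, b), (a', b')) \<in> parcs (G \<boxtimes> H)" "c \<in> pverts G" "d \<in> pverts H" for a b a' b' c d
    using lip[of a a' c] lip'[of b b' d] that by (auto simp: arcs)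
  show ?thesis
    unfolding is_distance_def verts
  proof (intro conjI allI ballI impI)
    fix u v w assume "(u, v) \<in> parcs (G \<boxtimes> H)" "w \<in> pverts G \<times> pverts H"
    then show "max (f (fst u) (fst w)) (g (snd u) (snd w)) \<le>
        Suc (max (f (fst v) (fst w)) (g (snd v) (snd w)))"
      using lip_prod[of "fst u" "snd u" "fst v" "snd v" "fst w" "snd w"] by auto
  next
    fix u w assume "u \<in> pverts G \<times> pverts H" "w \<in> pverts G \<times> pverts H" "u \<noteq> w"
    then show "\<exists>v. (u, v) \<in> parcs (G \<boxtimes> H) \<and>
        max (f (fst u) (fst w)) (g (snd u) (snd w)) =
        Suc (max (f (fst v) (fst w)) (g (snd v) (snd w)))"
      using step_prod[of "fst u" "snd u" "fst w" "snd w"] by (auto simp: prod_eq_iff)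
  next
    fix u v assume "u \<in> pverts G \<times> pverts H" "v \<in> pverts G \<times> pverts H"
    then show "max (f (fst u) (fst v)) (g (snd u) (snd v)) = 0 \<longleftrightarrow> u = v"
      using zero[of "fst u" "fst v"] zero'[of "snd u" "snd v"]
      by (auto simp: prod_eq_iff simp flip: le_zero_eq)
  qed
qed

text \<open>
  The explicit formula for the distance in \<open>C\<^sub>n\<close>, meant for \<open>i < n\<close> and \<open>j < n\<close>: the shorter of the
  two arcs between \<open>i\<close> and \<open>j\<close>.
\<close>

definition cyc_dist :: "nat \<Rightarrow> nat \<Rightarrow> nat \<Rightarrow> nat" where
  "cyc_dist n i j = (if i \<le> j then min (j - i) (n - (j - i)) else min (i - j) (n - (i - j)))"

text \<open>
  The distance is the only number up to \<open>n / 2\<close> congruent to \<open>\<plusminus>(b - a)\<close> modulo \<open>n\<close>.  In this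
  form, without truncated subtraction, facts about it become linear arithmetic.
\<close>

lemma cyc_dist_eq_iff:
  assumes "a < n" "b < n"
  shows "cyc_dist n a b = d \<longleftrightarrow>
    2 * d \<le> n \<and> (b = a + d \<or> a = b + d \<or> b + n = a + d \<or> a + n = b + d)"
  using assms unfolding cyc_dist_def by (cases "a \<le> b") (auto simp: min_def)

lemma cyc_dist_triangle:
  assumes "a < n" "b < n" "c < n"
  shows "cyc_dist n a c \<le> cyc_dist n a b + cyc_dist n b c"
proof -
  obtain x y z where xyz: "cyc_dist n a c = x" "cyc_dist n a b = y" "cyc_dist n b c = z" by blast
  have x: "2 * x \<le> n" "c = a + x \<or> a = c + x \<or> c + n = a + x \<or> a + n = c + x"
    using xyz(1) assms by (auto simp: cyc_dist_eq_iff)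
  have y: "b = a + y \<or> a = b + y \<or> b + n = a + y \<or> a + n = b + y"
    using xyz(2) assms by (auto simp: cyc_dist_eq_iff)
  have z: "c = b + z \<or> b = c + z \<or> c + n = b + z \<or> b + n = c + z"
    using xyz(3) assms by (auto simp: cyc_dist_eq_iff)
  have "x \<le> y + z"
    using x(2) y z x(1) assms by (elim disjE) linarith+
  then show ?thesis using xyz by simp
qed

lemma is_distance_cycle_graph:
  assumes "n \<ge> 3"
  shows "is_distance (cycle_graph n) (cyc_dist n)"
proof -
  define adj where
    "adj i j \<longleftrightarrow> j = Suc i \<or> i = Suc j \<or> i = 0 \<and> Suc j = n \<or> j = 0 \<and> Suc i = n" for i j
  have arcs: "(i, j) \<in> parcs (cycle_graph n) \<longleftrightarrow> i < n \<and> j < n \<and> adj i j" for i j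
    using assms by (cases "Suc i = n"; cases "Suc j = n") (auto simp: cycle_graph_def adj_def)
  have step: "\<exists>j. (i, j) \<in> parcs (cycle_graph n) \<and> cyc_dist n i l = Suc (cyc_dist n j l)"
    if il: "i < n" "l < n" "i \<noteq> l" for i l
  proof -
    obtain d where d: "cyc_dist n i l = Suc d"
      using il by (cases "cyc_dist n i l") (auto simp: cyc_dist_eq_iff)
    then have half: "2 * Suc d \<le> n"
      and "l = i + Suc d \<or> l + n = i + Suc d \<or> i = l + Suc d \<or> i + n = l + Suc d"
      using il by (auto simp: cyc_dist_eq_iff)
    \<comment> \<open>The first three cases step up and the last three step down; in each direction the
        geodesic avoids the passage between \<open>n - 1\<close> and \<open>0\<close>, meets it later or starts with it.\<close>
    then consider "l = Suc i + d" | "Suc i < n" "l + n = Suc i + d" | "Suc i = n" "l = d"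
      | "i = Suc (l + d)" | "i = 0" "n = Suc (l + d)" | i' where "i = Suc i'" "i' + n = l + d"
      using il by (cases i; cases "Suc i = n") auto
    then obtain j where j: "j < n" "adj i j"
      "l = j + d \<or> j = l + d \<or> l + n = j + d \<or> j + n = l + d"
    proof cases
      case 1 then show ?thesis using il by (intro that[of "Suc i"]) (auto simp: adj_def)
    next
      case 2 then show ?thesis using il by (intro that[of "Suc i"]) (auto simp: adj_def)
    next
      case 3 then show ?thesis using il by (intro that[of 0]) (auto simp: adj_def)
    next
      case 4 then show ?thesis using il by (intro that[of "i - 1"]) (auto simp: adj_def)
    next
      case 5 then show ?thesis using il by (intro that[of "n - 1"]) (auto simp: adj_def)
    next
      case (6 i') then show ?thesis using il by (intro that[of i']) (auto simp: adj_def)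
    qed
    then have "cyc_dist n j l = d" using il half by (simp add: cyc_dist_eq_iff)
    then show ?thesis using d j il by (auto simp: arcs)
  qed
  have lip: "cyc_dist n i l \<le> Suc (cyc_dist n j l)"
    if "(i, j) \<in> parcs (cycle_graph n)" "l < n" for i j l
  proof -
    have ij: "i < n" "j < n" "adj i j" using that by (auto simp: arcs)
    then have "cyc_dist n i j \<le> 1" by (auto simp: adj_def cyc_dist_def)
    with cyc_dist_triangle[of i n j l] ij that show ?thesis by simp
  qed
  have "cyc_dist n i j = 0 \<longleftrightarrow> i = j" if "i < n" "j < n" for i j
    using that by (auto simp: cyc_dist_def)
  with step lip show ?thesis
    by (auto simp: is_distance_def cycle_graph_def)
qed

lemma cyc_dist_commute: "cyc_dist n a b = cyc_dist n b a"
  by (auto simp: cyc_dist_def)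

lemma cyc_dist_le_half: "cyc_dist n a b \<le> n div 2"
  by (auto simp: cyc_dist_def)

lemma cyc_dist_mult: "cyc_dist (k * n) (k * a) (k * b) = k * cyc_dist n a b"
  by (cases "k = 0") (auto simp: cyc_dist_def min_def simp flip: diff_mult_distrib2)

text \<open>
  For \<open>a < b < c < d\<close>, the arc from \<open>a\<close> up to \<open>c\<close> passes \<open>b\<close> and the complementary arc passes \<open>d\<close>.
  One of the two has length at most \<open>n / 2\<close> and is a geodesic.
\<close>

lemma four_on_cycle_between:
  assumes sub: "X \<subseteq> {..<n}" and card: "card X \<ge> 4"
  obtains a b c where "a \<in> X" "b \<in> X" "c \<in> X" "a \<noteq> b" "b \<noteq> c" "a \<noteq> c"
    "cyc_dist n a c = cyc_dist n a b + cyc_dist n b c"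
proof -
  have fin: "finite X" using sub finite_subset by blast
  define xs where "xs = sorted_list_of_set X"
  have len: "length xs \<ge> 4" using card by (simp add: xs_def)
  have inX: "xs ! i \<in> X" if "i < 4" for i
    using that len nth_mem[of i xs] fin by (simp add: xs_def)
  have lt: "xs ! i < xs ! j" if "i < j" "j < 4" for i j
    using that len sorted_wrt_nth_less[OF strict_sorted_list_of_set[of X]]
    by (simp add: xs_def)
  let ?a = "xs ! 0" and ?b = "xs ! 1" and ?c = "xs ! 2" and ?d = "xs ! 3"
  have ord: "?a < ?b" "?b < ?c" "?c < ?d" by (auto intro: lt)
  have dn: "?d < n" using inX[of 3] sub by auto
  show ?thesis
  proof (cases "2 * (?c - ?a) \<le> n")
    case True
    then have "cyc_dist n ?a ?c = cyc_dist n ?a ?b + cyc_dist n ?b ?c"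
      using ord dn by (auto simp: cyc_dist_def)
    then show ?thesis using that[of ?a ?b ?c] inX ord by auto
  next
    case False
    then have "cyc_dist n ?c ?a = cyc_dist n ?c ?d + cyc_dist n ?d ?a"
      using ord dn by (auto simp: cyc_dist_def min_def)
    then show ?thesis using that[of ?c ?d ?a] inX ord by auto
  qed
qed

section \<open>At most 11 points on any torus\<close>

abbreviation torus_dist :: "nat \<Rightarrow> nat \<Rightarrow> nat \<times> nat \<Rightarrow> nat \<times> nat \<Rightarrow> nat" where
  "torus_dist m n u v \<equiv> max (cyc_dist m (fst u) (fst v)) (cyc_dist n (snd u) (snd v))"

lemma general_position_torus_iff:
  assumes "m \<ge> 3" "n \<ge> 3"
  shows "general_position (cycle_graph m \<boxtimes> cycle_graph n) S \<longleftrightarrow> S \<subseteq> {..<m} \<times> {..<n} \<and>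
    (\<forall>u\<in>S. \<forall>v\<in>S. \<forall>w\<in>S. u \<noteq> v \<and> u \<noteq> w \<and> v \<noteq> w \<longrightarrow>
       torus_dist m n u v \<noteq> torus_dist m n u w + torus_dist m n w v)"
proof -
  have "pverts (cycle_graph m \<boxtimes> cycle_graph n) = {..<m} \<times> {..<n}"
    by (simp add: strong_product_def cycle_graph_def)
  moreover have "is_distance (cycle_graph m \<boxtimes> cycle_graph n) (torus_dist m n)"
    by (intro is_distance_strong_product is_distance_cycle_graph pair_graph_cycle_graph assms)
  moreover have "strongly_connected (with_proj (cycle_graph m \<boxtimes> cycle_graph n))"
    using assms by (intro strongly_connected_strong_product strongly_connected_cycle_graph
        pair_graph_cycle_graph) auto
  moreover have "pair_graph (cycle_graph m \<boxtimes> cycle_graph n)"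
    by (intro pair_graph_strong_product pair_graph_cycle_graph)
  ultimately show ?thesis
    by (simp only: general_position_iff_is_distance)
qed

locale torus_general_position =
  fixes m n :: nat and S :: "(nat \<times> nat) set"
  assumes sub: "S \<subseteq> {..<m} \<times> {..<n}"
    and no_between: "\<And>u v w. \<lbrakk>u \<in> S; v \<in> S; w \<in> S; u \<noteq> v; u \<noteq> w; v \<noteq> w\<rbrakk> \<Longrightarrow>
      torus_dist m n u v \<noteq> torus_dist m n u w + torus_dist m n w v"
begin

lemma finite_S: "finite S"
  using sub finite_subset by blast

text \<open>
  Among vertical displacements the distance is that of the second coordinates, which are
  therefore distinct, and no one of them may lie between two others on its cycle.
\<close>

lemma card_vertical_le_3:
  assumes Y: "Y \<subseteq> S"
    and vert: "\<And>u v. \<lbrakk>u \<in> Y; v \<in> Y; u \<noteq> v\<rbrakk> \<Longrightarrow>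
      cyc_dist m (fst u) (fst v) < cyc_dist n (snd u) (snd v)"
  shows "card Y \<le> 3"
proof (rule ccontr)
  assume "\<not> card Y \<le> 3"
  have "inj_on snd Y"
  proof (rule inj_onI)
    fix u v assume "u \<in> Y" "v \<in> Y" "snd u = snd v"
    then show "u = v" using vert[of u v] by (auto simp: cyc_dist_def)
  qed
  then have "card (snd ` Y) \<ge> 4"
    using \<open>\<not> card Y \<le> 3\<close> by (simp add: card_image)
  moreover have "snd ` Y \<subseteq> {..<n}"
    using sub Y by auto
  ultimately obtain a b c where "a \<in> snd ` Y" "b \<in> snd ` Y" "c \<in> snd ` Y"
      "a \<noteq> b" "b \<noteq> c" "a \<noteq> c" "cyc_dist n a c = cyc_dist n a b + cyc_dist n b c"
    by (elim four_on_cycle_between)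
  then obtain u v w where uvw: "u \<in> Y" "w \<in> Y" "v \<in> Y"
      "snd u \<noteq> snd w" "snd w \<noteq> snd v" "snd u \<noteq> snd v"
      "cyc_dist n (snd u) (snd v) = cyc_dist n (snd u) (snd w) + cyc_dist n (snd w) (snd v)"
    by blast
  then have ne: "u \<noteq> v" "u \<noteq> w" "w \<noteq> v" by auto
  have "torus_dist m n u v = torus_dist m n u w + torus_dist m n w v"
    using vert[of u v] vert[of u w] vert[of w v] uvw ne by auto
  then show False
    using no_between[of u v w] uvw ne Y by blast
qed

text \<open>
  The function \<open>off\<close> is the column of a point counted from one border of the strip.  The assumption
  on it says that the strip is at most half as wide as the torus, so that distances along the first
  cycle are differences of columns.
\<close>

lemma card_half_strip_le_6:
  assumes A: "A \<subseteq> S"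
    and off: "\<And>u v. \<lbrakk>u \<in> A; v \<in> A; off u \<le> off v\<rbrakk> \<Longrightarrow>
      cyc_dist m (fst u) (fst v) = off v - (off u :: nat)"
  shows "card A \<le> 6"
proof -
  define less where "less u v \<longleftrightarrow> off u < off v \<and> cyc_dist n (snd u) (snd v) \<le> off v - off u"
    for u v
  have no_chain: False
    if "u \<in> A" "w \<in> A" "v \<in> A" "less u w" "less w v" for u v w
  proof -
    have ord: "off u < off w" "off w < off v" using that by (auto simp: less_def)
    have "snd u < n" "snd v < n" "snd w < n" using that A sub by auto
    then have "cyc_dist n (snd u) (snd v) \<le> off v - off u"
      using cyc_dist_triangle[of "snd u" n "snd w" "snd v"] that by (auto simp: less_def)
    then have "torus_dist m n u v = torus_dist m n u w + torus_dist m n w v"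
      using that ord off[of u v] off[of u w] off[of w v] by (auto simp: less_def)
    moreover have "u \<noteq> v" "u \<noteq> w" "v \<noteq> w" using ord by auto
    ultimately show False using no_between[of u v w] that A by blast
  qed
  \<comment> \<open>Incomparable points of the strip are displaced vertically.\<close>
  have anti: "card Y \<le> 3"
    if "Y \<subseteq> A" and "\<And>u v. \<lbrakk>u \<in> Y; v \<in> Y\<rbrakk> \<Longrightarrow> \<not> less u v" for Y
  proof (rule card_vertical_le_3)
    show "Y \<subseteq> S" using that A by blast
    fix u v assume uv: "u \<in> Y" "v \<in> Y" "u \<noteq> v"
    have main: "cyc_dist m (fst u) (fst v) < cyc_dist n (snd u) (snd v)"
      if "u \<in> Y" "v \<in> Y" "u \<noteq> v" "off u \<le> off v" for u v
    proof (cases "off u = off v")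
      case True
      have "u \<in> A" "v \<in> A" using that \<open>Y \<subseteq> A\<close> by auto
      then have lt: "fst u < m" "fst v < m" "snd u < n" "snd v < n" using A sub by auto
      have "cyc_dist m (fst u) (fst v) = 0"
        using off[OF \<open>u \<in> A\<close> \<open>v \<in> A\<close>] True by simp
      moreover from this have "fst u = fst v"
        using lt by (auto simp: cyc_dist_def split: if_splits)
      then have "snd u \<noteq> snd v" using \<open>u \<noteq> v\<close> by (auto simp: prod_eq_iff)
      then have "cyc_dist n (snd u) (snd v) > 0"
        using lt by (auto simp: cyc_dist_def)
      ultimately show ?thesis by simp
    next
      case False
      have "u \<in> A" "v \<in> A" using that \<open>Y \<subseteq> A\<close> by auto
      moreover have "\<not> less u v" using that \<open>\<And>u v. \<lbrakk>u \<in> Y; v \<in> Y\<rbrakk> \<Longrightarrow> \<not> less u v\<close> by blast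
      ultimately show ?thesis using False that(4) off[of u v] by (auto simp: less_def)
    qed
    show "cyc_dist m (fst u) (fst v) < cyc_dist n (snd u) (snd v)"
      using main[of u v] main[of v u] uv cyc_dist_commute by (metis nat_le_linear)
  qed
  \<comment> \<open>The points that are not minimal; as there is no chain of three, they form an antichain.\<close>
  define B where "B = {v \<in> A. \<exists>u\<in>A. less u v}"
  have "card (A - B) \<le> 3" by (rule anti) (auto simp: B_def)
  moreover have "card B \<le> 3" by (rule anti) (use no_chain in \<open>auto simp: B_def\<close>)
  moreover have "card A = card B + card (A - B)"
    using finite_subset[OF A finite_S] card_Diff_subset[of B A] card_mono[of A B]
    by (auto simp: B_def intro: finite_subset)
  ultimately show ?thesis by simp
qed

theorem card_le_11: "card S \<le> 11"
proof (cases "S = {}")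
  case False
  then obtain p where p: "p \<in> S" by blast
  define c where "c = fst p"
  have cm: "c < m" using p sub by (auto simp: c_def)
  define right where "right u = (if c \<le> fst u then fst u - c else fst u + m - c)"
    for u :: "nat \<times> nat"
  define left where "left u = (if fst u \<le> c then c - fst u else c + m - fst u)"
    for u :: "nat \<times> nat"
  have lt: "fst u < m" if "u \<in> S" for u using that sub by auto
  define A where "A = {u \<in> S. 2 * right u \<le> m}"
  define B where "B = {u \<in> S. 2 * left u \<le> m}"
  have "card A \<le> 6"
  proof (rule card_half_strip_le_6)
    fix u v assume "u \<in> A" "v \<in> A" "right u \<le> right v"
    then show "cyc_dist m (fst u) (fst v) = right v - right u"
      using lt[of u] lt[of v] cm
      by (cases "c \<le> fst u"; cases "c \<le> fst v") (auto simp: A_def right_def cyc_dist_eq_iff)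
  qed (auto simp: A_def)
  moreover have "card B \<le> 6"
  proof (rule card_half_strip_le_6)
    fix u v assume "u \<in> B" "v \<in> B" "left u \<le> left v"
    then show "cyc_dist m (fst u) (fst v) = left v - left u"
      using lt[of u] lt[of v] cm
      by (cases "fst u \<le> c"; cases "fst v \<le> c") (auto simp: B_def left_def cyc_dist_eq_iff)
  qed (auto simp: B_def)
  moreover have "S = A \<union> B"
  proof -
    have "2 * right u \<le> m \<or> 2 * left u \<le> m" if "u \<in> S" for u
      using lt[OF that] cm by (auto simp: left_def right_def)
    then show ?thesis by (auto simp: A_def B_def)
  qed
  moreover have "card (A \<inter> B) > 0"
  proof -
    have "p \<in> A \<inter> B" using p by (simp add: A_def B_def left_def right_def c_def)
    moreover have "finite (A \<inter> B)" using finite_S by (simp add: A_def)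
    ultimately show ?thesis using card_gt_0_iff by blast
  qed
  moreover have "card A + card B = card (A \<union> B) + card (A \<inter> B)"
    using finite_S by (intro card_Un_Int) (auto simp: A_def B_def)
  ultimately show ?thesis by simp
qed simp

end

section \<open>A lattice of 11 points in general position\<close>

definition skew_lattice :: "nat \<Rightarrow> (nat \<times> nat) set" where
  "skew_lattice k = (\<lambda>i. (k * i, k * (3 * i mod 11))) ` {..<11}"

text \<open>
  On the torus of side 11, the differences of lattice points are, up to sign, \<open>(1, 3)\<close>, \<open>(2, -5)\<close>,
  \<open>(3, -2)\<close>, \<open>(4, 1)\<close> and \<open>(5, 4)\<close>, so the distance is at least 3; being at most half of 11, every
  distance is at most 5.
\<close>

lemma skew_lattice_dist:
  assumes "u \<in> skew_lattice k" "v \<in> skew_lattice k" "u \<noteq> v"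
  shows "3 * k \<le> torus_dist (11 * k) (11 * k) u v" "torus_dist (11 * k) (11 * k) u v \<le> 5 * k"
proof -
  obtain i j where ij: "i < 11" "j < 11" "u = (k * i, k * (3 * i mod 11))"
      "v = (k * j, k * (3 * j mod 11))"
    using assms(1,2) by (auto simp: skew_lattice_def)
  have d: "torus_dist (11 * k) (11 * k) u v =
      k * max (cyc_dist 11 i j) (cyc_dist 11 (3 * i mod 11) (3 * j mod 11))"
    using cyc_dist_mult[of k 11] by (simp add: ij mult.commute[of 11] nat_mult_max_right)
  let ?I = "{0, 1, 2, 3, 4, 5, 6, 7, 8, 9, 10} :: nat set"
  have separated: "\<forall>i\<in>?I. \<forall>j\<in>?I. i \<noteq> j \<longrightarrow>
      3 \<le> max (cyc_dist 11 i j) (cyc_dist 11 (3 * i mod 11) (3 * j mod 11))"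
    by (simp only: ball_simps) (simp add: cyc_dist_def)
  have "i \<in> ?I" "j \<in> ?I" using ij(1,2) unfolding insert_iff empty_iff by presburger+
  moreover have "i \<noteq> j" using assms(3) ij by auto
  ultimately have "3 \<le> max (cyc_dist 11 i j) (cyc_dist 11 (3 * i mod 11) (3 * j mod 11))"
    using separated by blast
  then show "3 * k \<le> torus_dist (11 * k) (11 * k) u v"
    unfolding d by (simp add: mult.commute)
  have "max (cyc_dist 11 i j) (cyc_dist 11 (3 * i mod 11) (3 * j mod 11)) \<le> 5"
    using cyc_dist_le_half[of 11] by simp
  then show "torus_dist (11 * k) (11 * k) u v \<le> 5 * k"
    unfolding d by (simp add: mult.commute)
qed

lemma card_skew_lattice:
  assumes "k > 0"
  shows "card (skew_lattice k) = 11"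
  using assms unfolding skew_lattice_def by (subst card_image) (auto simp: inj_on_def)

theorem corollary4p11:
  fixes k :: nat
  assumes "k \<ge> 1"
  shows "gp (cycle_graph (11 * k) \<boxtimes> cycle_graph (11 * k)) = 11"
proof -
  let ?G = "cycle_graph (11 * k) \<boxtimes> cycle_graph (11 * k)" and ?d = "torus_dist (11 * k) (11 * k)"
  have n: "11 * k \<ge> 3" using assms by simp
  note gp_iff = general_position_torus_iff[OF n n]
  have "general_position ?G (skew_lattice k)"
    unfolding gp_iff
  proof (intro conjI ballI impI)
    show "skew_lattice k \<subseteq> {..<11 * k} \<times> {..<11 * k}"
      using assms by (auto simp: skew_lattice_def)
    fix u v w
    assume uvw: "u \<in> skew_lattice k" "v \<in> skew_lattice k" "w \<in> skew_lattice k"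
      and ne: "u \<noteq> v \<and> u \<noteq> w \<and> v \<noteq> w"
    have "?d u v \<le> 5 * k"
      using skew_lattice_dist(2)[OF uvw(1,2)] ne by blast
    moreover have "3 * k \<le> ?d u w" "3 * k \<le> ?d w v"
      using skew_lattice_dist(1)[OF uvw(1,3)] skew_lattice_dist(1)[OF uvw(3,2)] ne by blast+
    ultimately show "?d u v \<noteq> ?d u w + ?d w v" using assms by linarith
  qed
  moreover have "card S \<le> 11" if "general_position ?G S" for S
  proof -
    interpret torus_general_position "11 * k" "11 * k" S
      using that unfolding gp_iff by unfold_locales blast+
    show ?thesis by (rule card_le_11)
  qed
  moreover have "finite {S. general_position ?G S}"
    by (rule finite_subset[of _ "Pow ({..<11 * k} \<times> {..<11 * k})"]) (auto simp: gp_iff)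
  ultimately show ?thesis
    unfolding gp_def using card_skew_lattice[of k] assms
    by (intro Max_eqI) (auto simp: image_iff intro!: exI[of _ "skew_lattice k"])
qed

end
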